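(* Let $B$ be a group such that for every family of groups $(G_i)_{i\in I}$ and every homomorphism $f:\prod_{i\in I}G_i\to B$ for which the composite $\pi f:\prod_{i\in I}G_i\to B/Z(B)$ is surjective, the map $\pi f$ factors through the natural map from $\prod_{i\in I}G_i$ to the direct product of finitely many ultraproducts of the $G_i$. Suppose, moreover, that for every almost direct factor $B'\neq Z(B)$ of $B$, the group $B'/Z(B)$ contains at least one element $b$ which does not lie in any subgroup of $B'/Z(B)$ that is a homomorphic image of a nonprincipal countable ultraproduct $\mathbb Z^\omega/\mathcal U$ of copies of $\mathbb Z$. Then for every family of groups $(G_i)_{i\in I}$ such that $\mathrm{card}(I)$ is less than every uncountable measurable cardinal (if any such cardinals exist), and every homomorphism $f:\prod_{i\in I}G_i\to B$ such that $\pi f$ is surjective, the composite $\pi f:\prod_{i\in I}G_i\to B/Z(B)$ factors through the projection of $\prod_{i\in I}G_i$ to the direct product of finitely many of the $G_i$.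
   Context: $Z(B)$ denotes the center of $B$, and $\pi:B\to B/Z(B)$ the quotient map. Subgroups $B',B''$ of $B$ are called almost direct factors of $B$ (forming such a pair) if $B=B'B''$ and each of $B',B''$ is the centralizer in $B$ of the other; a subgroup $B'$ belonging to such a pair is called an almost direct factor of $B$ (it then contains $Z(B)$). A homomorphism on $\prod_{i\in I}G_i$ factors through the natural map to the direct product of finitely many ultraproducts if, for some finite (possibly empty) family of ultrafilters $\mathcal U_0,\dots,\mathcal U_{n-1}$ on $I$ (principal or not), it is the composite of the natural map $\prod_{i\in I}G_i\to\prod_{i\in I}G_i/\mathcal U_0\times\dots\times\prod_{i\in I}G_i/\mathcal U_{n-1}$ with a homomorphism defined on that product. A nonprincipal countable ultraproduct is an ultraproduct of a family indexed by $\omega$ with respect to a nonprincipal ultrafilter $\mathcal U$ on $\omega$. Measurable cardinals are defined so that $\aleph_0$ counts as measurable; "uncountable measurable cardinal" is what many authors call simply a measurable cardinal (an uncountable cardinal $\kappa$ carrying a nonprincipal $\kappa$-complete ultrafilter). *)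

theory Defs
  imports "HOL-Algebra.Product_Groups"
begin

unbundle cardinal_syntax

definition centralizer :: "('b, 'm) monoid_scheme \<Rightarrow> 'b set \<Rightarrow> 'b set" where
  "centralizer B S = {x \<in> carrier B. \<forall>s\<in>S. x \<otimes>\<^bsub>B\<^esub> s = s \<otimes>\<^bsub>B\<^esub> x}"

definition center :: "('b, 'm) monoid_scheme \<Rightarrow> 'b set" where
  "center B = centralizer B (carrier B)"

definition center_proj :: "('b, 'm) monoid_scheme \<Rightarrow> 'b \<Rightarrow> 'b set" where
  "center_proj B x = center B #>\<^bsub>B\<^esub> x"

definition almost_direct_pair :: "('b, 'm) monoid_scheme \<Rightarrow> 'b set \<Rightarrow> 'b set \<Rightarrow> bool" where
  "almost_direct_pair B B' B'' \<longleftrightarrow>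
     subgroup B' B \<and> subgroup B'' B \<and> carrier B = B' <#>\<^bsub>B\<^esub> B'' \<and>
     B' = centralizer B B'' \<and> B'' = centralizer B B'"

definition almost_direct_factor :: "('b, 'm) monoid_scheme \<Rightarrow> 'b set \<Rightarrow> bool" where
  "almost_direct_factor B B' \<longleftrightarrow> (\<exists>B''. almost_direct_pair B B' B'')"

definition ultrafilter_on :: "'i set \<Rightarrow> 'i set set \<Rightarrow> bool" where
  "ultrafilter_on I U \<longleftrightarrow>
     U \<subseteq> Pow I \<and> I \<in> U \<and> {} \<notin> U \<and>
     (\<forall>A\<in>U. \<forall>C. A \<subseteq> C \<and> C \<subseteq> I \<longrightarrow> C \<in> U) \<and>
     (\<forall>A\<in>U. \<forall>C\<in>U. A \<inter> C \<in> U) \<and>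
     (\<forall>A. A \<subseteq> I \<longrightarrow> A \<in> U \<or> I - A \<in> U)"

definition nonprincipal_ultrafilter_on :: "'i set \<Rightarrow> 'i set set \<Rightarrow> bool" where
  "nonprincipal_ultrafilter_on I U \<longleftrightarrow>
     ultrafilter_on I U \<and> \<not> (\<exists>i\<in>I. U = {A. A \<subseteq> I \<and> i \<in> A})"

definition complete_filter :: "'k rel \<Rightarrow> 'i set set \<Rightarrow> bool" where
  "complete_filter \<kappa> U \<longleftrightarrow> (\<forall>S. S \<subseteq> U \<and> S \<noteq> {} \<and> |S| <o \<kappa> \<longrightarrow> \<Inter>S \<in> U)"

text \<open>Cardinals are represented as in the library, by initial well-orders \<open>\<kappa>\<close>, the
  underlying set being \<open>Field \<kappa>\<close>. With this definition \<open>natLeq\<close> is measurable.\<close>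

definition measurable_cardinal :: "'k rel \<Rightarrow> bool" where
  "measurable_cardinal \<kappa> \<longleftrightarrow>
     Card_order \<kappa> \<and>
     (\<exists>U. nonprincipal_ultrafilter_on (Field \<kappa>) U \<and> complete_filter \<kappa> U)"

text \<open>It suffices to let \<open>\<kappa>\<close> range over the cardinals on the type \<open>'i\<close>: any other cardinal
  is larger than \<open>|UNIV :: 'i set|\<close>, hence automatically larger than \<open>|I|\<close>.\<close>

definition below_uncountable_measurables :: "'i set \<Rightarrow> bool" where
  "below_uncountable_measurables I \<longleftrightarrow>
     (\<forall>\<kappa> :: 'i rel. measurable_cardinal \<kappa> \<and> natLeq <o \<kappa> \<longrightarrow> |I| <o \<kappa>)"

text \<open>Ultraproducts of groups: the quotient of the product by the elements that are trivial
  almost everywhere. By \<open>ultraproduct_map_eq_iff\<close> below, this is the quotient by agreement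
  almost everywhere.\<close>

definition trivial_ae :: "'i set \<Rightarrow> ('i \<Rightarrow> ('g, 'm) monoid_scheme) \<Rightarrow> 'i set set \<Rightarrow> ('i \<Rightarrow> 'g) set" where
  "trivial_ae I G U = {x \<in> carrier (product_group I G). {i \<in> I. x i = \<one>\<^bsub>G i\<^esub>} \<in> U}"

definition ultraproduct ::
  "'i set \<Rightarrow> ('i \<Rightarrow> ('g, 'm) monoid_scheme) \<Rightarrow> 'i set set \<Rightarrow> ('i \<Rightarrow> 'g) set monoid" where
  "ultraproduct I G U = product_group I G Mod trivial_ae I G U"

definition ultraproduct_map ::
  "'i set \<Rightarrow> ('i \<Rightarrow> ('g, 'm) monoid_scheme) \<Rightarrow> 'i set set \<Rightarrow> ('i \<Rightarrow> 'g) \<Rightarrow> ('i \<Rightarrow> 'g) set" where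
  "ultraproduct_map I G U x = trivial_ae I G U #>\<^bsub>product_group I G\<^esub> x"

definition factors_through_finitely_many_ultraproducts ::
  "'i set \<Rightarrow> ('i \<Rightarrow> ('g, 'm) monoid_scheme) \<Rightarrow> ('h, 'n) monoid_scheme \<Rightarrow> (('i \<Rightarrow> 'g) \<Rightarrow> 'h) \<Rightarrow> bool" where
  "factors_through_finitely_many_ultraproducts I G H \<phi> \<longleftrightarrow>
     (\<exists>(n :: nat) U. (\<forall>k<n. ultrafilter_on I (U k)) \<and>
       (\<exists>h \<in> hom (product_group {..<n} (\<lambda>k. ultraproduct I G (U k))) H.
          \<forall>x \<in> carrier (product_group I G).
            \<phi> x = h (\<lambda>k\<in>{..<n}. ultraproduct_map I G (U k) x)))"

definition factors_through_finite_subproduct ::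
  "'i set \<Rightarrow> ('i \<Rightarrow> ('g, 'm) monoid_scheme) \<Rightarrow> ('h, 'n) monoid_scheme \<Rightarrow> (('i \<Rightarrow> 'g) \<Rightarrow> 'h) \<Rightarrow> bool" where
  "factors_through_finite_subproduct I G H \<phi> \<longleftrightarrow>
     (\<exists>J. J \<subseteq> I \<and> finite J \<and>
       (\<exists>h \<in> hom (product_group J G) H.
          \<forall>x \<in> carrier (product_group I G). \<phi> x = h (restrict x J)))"

definition image_of_countable_ultrapower_of_int :: "('h, 'n) monoid_scheme \<Rightarrow> 'h set \<Rightarrow> bool" where
  "image_of_countable_ultrapower_of_int Q K \<longleftrightarrow>
     subgroup K Q \<and>
     (\<exists>U. nonprincipal_ultrafilter_on (UNIV :: nat set) U \<and>
       epi (ultraproduct UNIV (\<lambda>_. integer_group) U) (Q\<lparr>carrier := K\<rparr>) \<noteq> {})"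


lemma center_normal:
  assumes "group B"
  shows "center B \<lhd> B"
proof -
  interpret group B by fact
  have inv_comm: "inv\<^bsub>B\<^esub> a \<otimes>\<^bsub>B\<^esub> s = s \<otimes>\<^bsub>B\<^esub> inv\<^bsub>B\<^esub> a"
    if "a \<in> carrier B" "s \<in> carrier B" and c: "a \<otimes>\<^bsub>B\<^esub> s = s \<otimes>\<^bsub>B\<^esub> a" for a s
  proof -
    have "inv\<^bsub>B\<^esub> a \<otimes>\<^bsub>B\<^esub> s \<otimes>\<^bsub>B\<^esub> a = s"
      using that(1,2) by (simp add: m_assoc c[symmetric]) (simp add: m_assoc[symmetric])
    then show ?thesis
      using that(1,2) by (metis inv_closed m_closed inv_solve_right)
  qed
  have "subgroup (center B) B"
  proof
    show "x \<otimes>\<^bsub>B\<^esub> y \<in> center B" if "x \<in> center B" "y \<in> center B" for x y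
      unfolding center_def centralizer_def
    proof safe
      have xy: "x \<in> carrier B" "y \<in> carrier B"
        using that by (auto simp: center_def centralizer_def)
      then show "x \<otimes>\<^bsub>B\<^esub> y \<in> carrier B" by simp
      fix s assume s: "s \<in> carrier B"
      have "x \<otimes>\<^bsub>B\<^esub> s = s \<otimes>\<^bsub>B\<^esub> x" "y \<otimes>\<^bsub>B\<^esub> s = s \<otimes>\<^bsub>B\<^esub> y"
        using that s by (auto simp: center_def centralizer_def)
      then show "x \<otimes>\<^bsub>B\<^esub> y \<otimes>\<^bsub>B\<^esub> s = s \<otimes>\<^bsub>B\<^esub> (x \<otimes>\<^bsub>B\<^esub> y)"
        using xy s by (metis m_assoc)
    qed
  qed (auto simp: center_def centralizer_def inv_comm)
  moreover have "x \<otimes>\<^bsub>B\<^esub> h \<otimes>\<^bsub>B\<^esub> inv\<^bsub>B\<^esub> x \<in> center B"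
    if "x \<in> carrier B" "h \<in> center B" for x h
  proof -
    have "h \<in> carrier B" "x \<otimes>\<^bsub>B\<^esub> h = h \<otimes>\<^bsub>B\<^esub> x"
      using that by (auto simp: center_def centralizer_def)
    then have "x \<otimes>\<^bsub>B\<^esub> h \<otimes>\<^bsub>B\<^esub> inv\<^bsub>B\<^esub> x = h"
      using that by (simp add: m_assoc)
    then show ?thesis using that by simp
  qed
  ultimately show ?thesis
    by (simp add: normal_inv_iff)
qed

lemma trivial_ae_normal:
  assumes G: "\<And>i. i \<in> I \<Longrightarrow> group (G i)" and U: "ultrafilter_on I U"
  shows "trivial_ae I G U \<lhd> product_group I G"
proof -
  interpret P: group "product_group I G" by (simp add: G)
  have up: "C \<in> U" if "A \<in> U" "A \<subseteq> C" "C \<subseteq> I" for A C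
    using U that unfolding ultrafilter_on_def by blast
  have int: "A \<inter> C \<in> U" if "A \<in> U" "C \<in> U" for A C
    using U that unfolding ultrafilter_on_def by blast
  have full: "I \<in> U"
    using U unfolding ultrafilter_on_def by blast
  note cl = group.is_monoid[OF G, THEN monoid.r_one] group.is_monoid[OF G, THEN monoid.one_closed]
  have "subgroup (trivial_ae I G U) (product_group I G)"
  proof (rule P.subgroupI)
    show "trivial_ae I G U \<subseteq> carrier (product_group I G)"
      by (auto simp: trivial_ae_def)
    have "{i \<in> I. \<one>\<^bsub>product_group I G\<^esub> i = \<one>\<^bsub>G i\<^esub>} = I" by auto
    then have "\<one>\<^bsub>product_group I G\<^esub> \<in> trivial_ae I G U"
      unfolding trivial_ae_def using full P.one_closed by simp
    then show "trivial_ae I G U \<noteq> {}" by blast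
  next
    fix a assume a: "a \<in> trivial_ae I G U"
    then have ac: "a \<in> carrier (product_group I G)" and aU: "{i \<in> I. a i = \<one>\<^bsub>G i\<^esub>} \<in> U"
      by (auto simp: trivial_ae_def)
    have "{i \<in> I. a i = \<one>\<^bsub>G i\<^esub>} \<subseteq> {i \<in> I. (inv\<^bsub>product_group I G\<^esub> a) i = \<one>\<^bsub>G i\<^esub>}"
      using ac G by (auto simp: group.is_monoid monoid.inv_one)
    with aU have "{i \<in> I. (inv\<^bsub>product_group I G\<^esub> a) i = \<one>\<^bsub>G i\<^esub>} \<in> U"
      by (rule up) auto
    then show "inv\<^bsub>product_group I G\<^esub> a \<in> trivial_ae I G U"
      using P.inv_closed[OF ac] by (simp only: trivial_ae_def mem_Collect_eq)
  next
    fix a b assume ab: "a \<in> trivial_ae I G U" "b \<in> trivial_ae I G U"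
    then have c: "a \<in> carrier (product_group I G)" "b \<in> carrier (product_group I G)"
      and "{i \<in> I. a i = \<one>\<^bsub>G i\<^esub>} \<inter> {i \<in> I. b i = \<one>\<^bsub>G i\<^esub>} \<in> U"
      by (auto simp: trivial_ae_def intro: int)
    then have "{i \<in> I. (a \<otimes>\<^bsub>product_group I G\<^esub> b) i = \<one>\<^bsub>G i\<^esub>} \<in> U"
      by (elim up) (auto simp: G cl)
    then show "a \<otimes>\<^bsub>product_group I G\<^esub> b \<in> trivial_ae I G U"
      using P.m_closed[OF c] by (simp only: trivial_ae_def mem_Collect_eq)
  qed
  moreover have "x \<otimes>\<^bsub>product_group I G\<^esub> h \<otimes>\<^bsub>product_group I G\<^esub> inv\<^bsub>product_group I G\<^esub> x \<in> trivial_ae I G U"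
    if x: "x \<in> carrier (product_group I G)" and h: "h \<in> trivial_ae I G U" for x h
  proof -
    have hc: "h \<in> carrier (product_group I G)" and "{i \<in> I. h i = \<one>\<^bsub>G i\<^esub>} \<in> U"
      using h by (auto simp: trivial_ae_def)
    then have "{i \<in> I. (x \<otimes>\<^bsub>product_group I G\<^esub> h \<otimes>\<^bsub>product_group I G\<^esub>
        inv\<^bsub>product_group I G\<^esub> x) i = \<one>\<^bsub>G i\<^esub>} \<in> U"
      using x by (elim up) (auto simp: G cl group.r_inv PiE_iff)
    then show ?thesis
      using P.m_closed[OF P.m_closed[OF x hc] P.inv_closed[OF x]]
      by (simp only: trivial_ae_def mem_Collect_eq)
  qed
  ultimately show ?thesis
    by (simp add: P.normal_inv_iff)
qed

lemma ultraproduct_map_eq_iff: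
  assumes G: "\<And>i. i \<in> I \<Longrightarrow> group (G i)" and U: "ultrafilter_on I U"
    and x: "x \<in> carrier (product_group I G)" and y: "y \<in> carrier (product_group I G)"
  shows "ultraproduct_map I G U x = ultraproduct_map I G U y \<longleftrightarrow> {i \<in> I. x i = y i} \<in> U"
proof -
  interpret P: group "product_group I G" by (simp add: G)
  interpret N: normal "trivial_ae I G U" "product_group I G"
    using trivial_ae_normal[OF G U] .
  have c: "x \<otimes>\<^bsub>product_group I G\<^esub> inv\<^bsub>product_group I G\<^esub> y \<in> carrier (product_group I G)"
    using P.m_closed[OF x P.inv_closed[OF y]] .
  have eq: "(x \<otimes>\<^bsub>product_group I G\<^esub> inv\<^bsub>product_group I G\<^esub> y) i = \<one>\<^bsub>G i\<^esub> \<longleftrightarrow> x i = y i"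
    if "i \<in> I" for i
  proof -
    interpret g: group "G i" using G that .
    have "x i \<in> carrier (G i)" "y i \<in> carrier (G i)" using x y that by auto
    then show ?thesis
      using y that G by simp (metis g.inv_closed g.inv_equality g.inv_inv g.r_inv)
  qed
  have "ultraproduct_map I G U x = ultraproduct_map I G U y \<longleftrightarrow>
      x \<otimes>\<^bsub>product_group I G\<^esub> inv\<^bsub>product_group I G\<^esub> y \<in> trivial_ae I G U"
    unfolding ultraproduct_map_def
    using x y N.is_subgroup P.rcos_self P.repr_independence N.rcos_module
    by (metis P.is_group)
  also have "\<dots> \<longleftrightarrow> {i \<in> I. x i = y i} \<in> U"
    using c eq by (simp only: trivial_ae_def mem_Collect_eq cong: conj_cong) auto
  finally show ?thesis .
qed

end

theory Submission
  imports Defs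
begin

text \<open>
By hypothesis, \<open>f x\<close> is central as soon as \<open>x\<close> is trivial almost everywhere for each of
finitely many ultrafilters on \<open>I\<close>; say that \<open>f\<close> is concentrated on them. The point is that any
nonprincipal ultrafilter \<open>V\<close> can be dropped from such a finite family
(\<open>concentrated_on_remove_nonprincipal\<close>). Once all have been dropped, the remaining ultrafilters are
principal, at the points of a finite set \<open>J\<close>; thus \<open>f x\<close> is central whenever \<open>x\<close> is trivial on
\<open>J\<close>, and modulo the center \<open>f x\<close> depends only on the restriction of \<open>x\<close> to \<open>J\<close>.

To drop \<open>V\<close>, let \<open>x\<close> be trivial almost everywhere for all the other ultrafilters of the family, and
split the product as \<open>P\<^sub>J \<times> P\<^sub>A\<close>, where \<open>J\<close> is the support of \<open>x\<close> and \<open>A\<close> is its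
complement. The two factors commute and their images generate \<open>B\<close> modulo the center, so the centralizer
\<open>B'\<close> of \<open>f P\<^sub>A\<close> is an almost direct factor, and it equals \<open>Z(B) \<cdot> f P\<^sub>J\<close>. Suppose that it is not
the center. Then some \<open>y\<close> in \<open>P\<^sub>J\<close> has an image in \<open>B' / Z(B)\<close> that avoids all homomorphic images
of nonprincipal countable ultrapowers of the integers. But since \<open>I\<close> is smaller than every
uncountable measurable cardinal, \<open>V\<close> is not countably complete: there is a map \<open>p\<close> from \<open>I\<close> to the
natural numbers all of whose fibres are \<open>V\<close>-null
(\<open>nonprincipal_ultrafilter_countable_null_partition\<close>). The homomorphism sending an integer sequence
\<open>a\<close> to the class of \<open>f\<close> at the family with entries \<open>y i [^] a (p i)\<close> kills every \<open>a\<close> that vanishes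
almost everywhere for the image of \<open>V\<close> under \<open>p\<close>: the resulting family is trivial almost
everywhere for \<open>V\<close>, and, having its support in \<open>J\<close>, for all the other ultrafilters as well. It
therefore factors through an ultrapower of the integers, and it sends the constant sequence 1 to the
class of \<open>f y\<close>, a contradiction. Hence \<open>B'\<close> is the center, and it contains \<open>f x\<close>.
\<close>

section \<open>Ultrafilters and their images\<close>
lemma ultrafilter_on_mono:
  "\<lbrakk>ultrafilter_on I U; A \<in> U; A \<subseteq> C; C \<subseteq> I\<rbrakk> \<Longrightarrow> C \<in> U"
  unfolding ultrafilter_on_def by blast

lemma ultrafilter_on_compl_iff:
  "\<lbrakk>ultrafilter_on I U; A \<subseteq> I\<rbrakk> \<Longrightarrow> I - A \<in> U \<longleftrightarrow> A \<notin> U"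
  unfolding ultrafilter_on_def by (metis Diff_disjoint)

lemma ultrafilter_on_empty: "ultrafilter_on I U \<Longrightarrow> {} \<notin> U"
  unfolding ultrafilter_on_def by blast

lemma ultrafilter_on_Int:
  "\<lbrakk>ultrafilter_on I U; A \<in> U; C \<in> U\<rbrakk> \<Longrightarrow> A \<inter> C \<in> U"
  unfolding ultrafilter_on_def by blast

lemma ultrafilter_on_null_Un:
  assumes "ultrafilter_on I U" "A \<subseteq> I" "C \<subseteq> I" "A \<notin> U" "C \<notin> U"
  shows "A \<union> C \<notin> U"
proof -
  have "(I - A) \<inter> (I - C) \<in> U"
    using assms by (simp add: ultrafilter_on_Int ultrafilter_on_compl_iff)
  then have "I - (A \<union> C) \<in> U" by (simp add: Diff_Un)
  then show ?thesis
    using assms ultrafilter_on_compl_iff[of I U "A \<union> C"] by simp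
qed

lemma nonprincipal_singleton_null:
  assumes "nonprincipal_ultrafilter_on I U" "i \<in> I"
  shows "{i} \<notin> U"
proof
  assume i: "{i} \<in> U"
  have U: "ultrafilter_on I U" and np: "U \<noteq> {A. A \<subseteq> I \<and> i \<in> A}"
    using assms by (auto simp: nonprincipal_ultrafilter_on_def)
  have "A \<in> U" if "A \<subseteq> I" "i \<in> A" for A
    using ultrafilter_on_mono[OF U i] that by simp
  moreover have "i \<in> A" "A \<subseteq> I" if "A \<in> U" for A
  proof -
    have "A \<inter> {i} \<in> U" by (rule ultrafilter_on_Int[OF U that i])
    with ultrafilter_on_empty[OF U] show "i \<in> A" by (cases "i \<in> A") auto
    show "A \<subseteq> I" using U that unfolding ultrafilter_on_def by blast
  qed
  ultimately show False using np by blast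
qed

definition pushforward :: "'i set \<Rightarrow> 'i set set \<Rightarrow> ('i \<Rightarrow> 't) \<Rightarrow> 't set \<Rightarrow> 't set set" where
  "pushforward I U p T = {A. A \<subseteq> T \<and> {i \<in> I. p i \<in> A} \<in> U}"

lemma ultrafilter_on_pushforward:
  assumes U: "ultrafilter_on I U" and p: "\<And>i. i \<in> I \<Longrightarrow> p i \<in> T"
  shows "ultrafilter_on T (pushforward I U p T)"
proof -
  have "{i \<in> I. p i \<in> T} = I" using p by auto
  moreover have "{i \<in> I. p i \<in> C} \<in> U" if "{i \<in> I. p i \<in> A} \<in> U" "A \<subseteq> C" for A C
    by (rule ultrafilter_on_mono[OF U that(1)]) (use that in auto)
  moreover have "{i \<in> I. p i \<in> A \<inter> C} \<in> U" if "{i \<in> I. p i \<in> A} \<in> U" "{i \<in> I. p i \<in> C} \<in> U" for A C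
  proof -
    have "{i \<in> I. p i \<in> A \<inter> C} = {i \<in> I. p i \<in> A} \<inter> {i \<in> I. p i \<in> C}" by auto
    then show ?thesis using ultrafilter_on_Int[OF U that] by simp
  qed
  moreover have "{i \<in> I. p i \<in> A} \<in> U \<or> {i \<in> I. p i \<in> T - A} \<in> U" for A
  proof -
    have "{i \<in> I. p i \<in> T - A} = I - {i \<in> I. p i \<in> A}" using p by auto
    then show ?thesis using ultrafilter_on_compl_iff[OF U, of "{i \<in> I. p i \<in> A}"] by auto
  qed
  ultimately show ?thesis
    using U unfolding ultrafilter_on_def pushforward_def by auto
qed

lemma nonprincipal_pushforward:
  assumes U: "ultrafilter_on I U" and p: "\<And>i. i \<in> I \<Longrightarrow> p i \<in> T"
    and null: "\<And>t. {i \<in> I. p i = t} \<notin> U"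
  shows "nonprincipal_ultrafilter_on T (pushforward I U p T)"
proof -
  have "{t} \<notin> pushforward I U p T" for t
    using null by (simp add: pushforward_def)
  then show ?thesis
    using ultrafilter_on_pushforward[of I U p T, OF U p] unfolding nonprincipal_ultrafilter_on_def by blast
qed

text \<open>If fewer than \<open>|T|\<close> sets of the image ultrafilter had a null intersection, then sending \<open>i\<close> to one of
those sets that misses \<open>p i\<close> would partition \<open>I\<close> into fewer than \<open>|T|\<close> null sets, against the
minimality of \<open>|T|\<close>.\<close>
lemma complete_pushforward_of_minimal_null_partition:
  fixes U :: "'i set set" and T :: "'i set"
  assumes U: "ultrafilter_on I U" and p: "\<And>i. i \<in> I \<Longrightarrow> p i \<in> T"
    and null: "\<And>t. {i \<in> I. p i = t} \<notin> U"
    and minimal: "\<And>(T' :: 'i set) q. (\<And>i. i \<in> I \<Longrightarrow> q i \<in> T') \<Longrightarrow>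
          (\<And>t. {i \<in> I. q i = t} \<notin> U) \<Longrightarrow> |T| \<le>o |T'|"
  shows "complete_filter |T| (pushforward I U p T)"
  unfolding complete_filter_def
proof (intro allI impI, elim conjE, rule ccontr)
  fix S assume S: "S \<subseteq> pushforward I U p T" "S \<noteq> {}" and less: "|S| <o |T|"
    and notin: "\<Inter>S \<notin> pushforward I U p T"
  obtain e where e: "inj_on e S" "e ` S \<subseteq> T"
    using ordLess_imp_ordLeq[OF less] card_of_ordLeq[of S T] by blast
  obtain A0 where A0: "A0 \<in> S" using S(2) by blast
  \<comment> \<open>The points whose image lies in all the sets form a null set; they join the fibre of \<open>A0\<close>.\<close>
  define c where "c i = (if p i \<in> \<Inter>S then A0 else SOME A. A \<in> S \<and> p i \<notin> A)" for i
  have c: "c i \<in> S" "p i \<in> \<Inter>S \<or> p i \<notin> c i" for i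
  proof -
    have "c i \<in> S \<and> (p i \<in> \<Inter>S \<or> p i \<notin> c i)"
    proof (cases "p i \<in> \<Inter>S")
      case False
      then have "\<exists>A. A \<in> S \<and> p i \<notin> A" by blast
      from someI_ex[OF this] show ?thesis by (simp only: c_def if_not_P[OF False]) simp
    qed (simp add: c_def A0)
    then show "c i \<in> S" "p i \<in> \<Inter>S \<or> p i \<notin> c i" by auto
  qed
  have "\<Inter>S \<subseteq> T" using S by (auto simp: pushforward_def)
  then have Int_null: "{i \<in> I. p i \<in> \<Inter>S} \<notin> U"
    using notin by (simp add: pushforward_def)
  have fibre: "{i \<in> I. c i = A} \<notin> U" if "A \<in> S" for A
  proof
    assume "{i \<in> I. c i = A} \<in> U"
    moreover have "{i \<in> I. c i = A} \<subseteq> (I - {i \<in> I. p i \<in> A}) \<union> {i \<in> I. p i \<in> \<Inter>S}"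
      using c(2) by auto
    ultimately have "(I - {i \<in> I. p i \<in> A}) \<union> {i \<in> I. p i \<in> \<Inter>S} \<in> U"
      by (rule ultrafilter_on_mono[OF U]) auto
    moreover have "I - {i \<in> I. p i \<in> A} \<notin> U"
      using S(1) that U by (subst ultrafilter_on_compl_iff) (auto simp: pushforward_def)
    ultimately show False
      using ultrafilter_on_null_Un[OF U _ _ _ Int_null] by blast
  qed
  \<comment> \<open>Minimality speaks of index sets in the type of \<open>I\<close>, hence the transport along \<open>e\<close>.\<close>
  have "{i \<in> I. (e \<circ> c) i = t} \<notin> U" for t
  proof (cases "\<exists>A\<in>S. t = e A")
    case True
    then obtain A where A: "A \<in> S" "t = e A" by blast
    then have "{i \<in> I. (e \<circ> c) i = t} = {i \<in> I. c i = A}"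
      using c(1) e(1) by (auto dest: inj_onD)
    then show ?thesis using fibre[OF A(1)] by simp
  next
    case False
    then have "{i \<in> I. (e \<circ> c) i = t} = {}" using c(1) by auto
    then show ?thesis using ultrafilter_on_empty[OF U] by metis
  qed
  then have "|T| \<le>o |e ` S|"
    using minimal[of "e \<circ> c" "e ` S"] c(1) by simp
  also have "|e ` S| \<le>o |S|" by (rule card_of_image)
  finally show False using less not_ordLess_ordLeq by blast
qed

text \<open>Partition \<open>I\<close> into as few null sets as possible, with index set \<open>T\<close>. Such a partition exists because
singletons are null. The image of \<open>U\<close> on \<open>T\<close> then shows that \<open>|T|\<close> is measurable, while
\<open>|T| \<le> |I|\<close>; so \<open>|T|\<close> cannot be uncountable.\<close>
lemma nonprincipal_ultrafilter_countable_null_partition: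
  fixes I :: "'i set"
  assumes small: "below_uncountable_measurables I" and np: "nonprincipal_ultrafilter_on I U"
  obtains p :: "'i \<Rightarrow> nat" where "\<And>n. {i \<in> I. p i = n} \<notin> U"
proof -
  have U: "ultrafilter_on I U" using np by (simp add: nonprincipal_ultrafilter_on_def)
  define P where "P T \<longleftrightarrow> (\<exists>p. (\<forall>i\<in>I. p i \<in> T) \<and> (\<forall>t. {i \<in> I. p i = t} \<notin> U))" for T :: "'i set"
  have "{i \<in> I. i = t} \<notin> U" for t
  proof (cases "t \<in> I")
    case True
    then have "{i \<in> I. i = t} = {t}" by auto
    then show ?thesis using nonprincipal_singleton_null[OF np True] by simp
  next
    case False
    then have "{i \<in> I. i = t} = {}" by auto
    then show ?thesis using ultrafilter_on_empty[OF U] by metis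
  qed
  then have PI: "P I" unfolding P_def by (intro exI[of _ "\<lambda>i. i"]) auto
  have "\<exists>r\<in>card_of ` Collect P. \<forall>r'\<in>card_of ` Collect P. r \<le>o r'"
    using PI by (intro exists_minim_Card_order) (auto simp: card_of_Card_order)
  then obtain T where PT: "P T" and min: "\<And>T'. P T' \<Longrightarrow> |T| \<le>o |T'|" by auto
  then obtain p where p: "\<And>i. i \<in> I \<Longrightarrow> p i \<in> T" "\<And>t. {i \<in> I. p i = t} \<notin> U"
    unfolding P_def by blast
  have "measurable_cardinal |T|"
    unfolding measurable_cardinal_def
  proof (intro conjI exI)
    show "nonprincipal_ultrafilter_on (Field |T| ) (pushforward I U p T)"
      unfolding Field_card_of using U p by (rule nonprincipal_pushforward)
    show "complete_filter |T| (pushforward I U p T)"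
      using U p
    proof (rule complete_pushforward_of_minimal_null_partition)
      show "|T| \<le>o |T'|" if "\<And>i. i \<in> I \<Longrightarrow> q i \<in> T'" "\<And>t. {i \<in> I. q i = t} \<notin> U" for T' :: "'i set" and q
        using min[of T'] that unfolding P_def by blast
    qed
  qed (rule card_of_Card_order)
  moreover have "\<not> |I| <o |T|" using min[OF PI] not_ordLess_ordLeq by blast
  ultimately have "\<not> natLeq <o |T|"
    using small unfolding below_uncountable_measurables_def by blast
  then have "|T| \<le>o natLeq"
    using ordLess_or_ordLeq[OF natLeq_Well_order card_of_Well_order, of T] by blast
  then have "|T| \<le>o |UNIV :: nat set|"
    using card_of_nat ordIso_symmetric ordLeq_ordIso_trans by blast
  then obtain e :: "'i \<Rightarrow> nat" where e: "inj_on e T"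
    using card_of_ordLeq[of T "UNIV :: nat set"] by blast
  have "{i \<in> I. (e \<circ> p) i = n} \<notin> U" for n
  proof (cases "\<exists>t\<in>T. n = e t")
    case True
    then obtain t where "t \<in> T" "n = e t" by blast
    then have "{i \<in> I. (e \<circ> p) i = n} = {i \<in> I. p i = t}"
      using e p(1) by (auto dest: inj_onD)
    then show ?thesis using p(2) by simp
  next
    case False
    then have "{i \<in> I. (e \<circ> p) i = n} = {}" using p(1) by auto
    then show ?thesis using ultrafilter_on_empty[OF U] by metis
  qed
  then show thesis by (rule that)
qed

section \<open>Centralizers and almost direct factors\<close>
lemma centralizer_antimono: "S \<subseteq> S' \<Longrightarrow> centralizer B S' \<subseteq> centralizer B S"
  by (auto simp: centralizer_def)

lemma subset_centralizer_centralizer: "S \<subseteq> carrier B \<Longrightarrow> S \<subseteq> centralizer B (centralizer B S)"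
  by (auto simp: centralizer_def)

lemma center_subset_centralizer: "S \<subseteq> carrier B \<Longrightarrow> center B \<subseteq> centralizer B S"
  unfolding center_def by (rule centralizer_antimono)

lemma subgroup_centralizer:
  assumes "group B" "S \<subseteq> carrier B"
  shows "subgroup (centralizer B S) B"
proof -
  interpret group B by fact
  show ?thesis
  proof
    show "centralizer B S \<subseteq> carrier B" by (auto simp: centralizer_def)
    show "\<one>\<^bsub>B\<^esub> \<in> centralizer B S" using assms(2) by (auto simp: centralizer_def)
  next
    fix x y assume "x \<in> centralizer B S" "y \<in> centralizer B S"
    then have xy: "x \<in> carrier B" "y \<in> carrier B"
      and c: "\<And>s. s \<in> S \<Longrightarrow> x \<otimes>\<^bsub>B\<^esub> s = s \<otimes>\<^bsub>B\<^esub> x" "\<And>s. s \<in> S \<Longrightarrow> y \<otimes>\<^bsub>B\<^esub> s = s \<otimes>\<^bsub>B\<^esub> y"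
      by (auto simp: centralizer_def)
    have "x \<otimes>\<^bsub>B\<^esub> y \<otimes>\<^bsub>B\<^esub> s = s \<otimes>\<^bsub>B\<^esub> (x \<otimes>\<^bsub>B\<^esub> y)" if "s \<in> S" for s
      using xy c[OF that] that assms(2) by (metis m_assoc subsetD)
    then show "x \<otimes>\<^bsub>B\<^esub> y \<in> centralizer B S" using xy by (simp add: centralizer_def)
  next
    fix x assume "x \<in> centralizer B S"
    then have x: "x \<in> carrier B" and c: "\<And>s. s \<in> S \<Longrightarrow> x \<otimes>\<^bsub>B\<^esub> s = s \<otimes>\<^bsub>B\<^esub> x"
      by (auto simp: centralizer_def)
    have "inv\<^bsub>B\<^esub> x \<otimes>\<^bsub>B\<^esub> s = s \<otimes>\<^bsub>B\<^esub> inv\<^bsub>B\<^esub> x" if "s \<in> S" for s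
    proof -
      have s: "s \<in> carrier B" using that assms(2) by blast
      have "inv\<^bsub>B\<^esub> x \<otimes>\<^bsub>B\<^esub> s \<otimes>\<^bsub>B\<^esub> x = s"
        using x s by (simp add: m_assoc c[OF that, symmetric]) (simp add: m_assoc[symmetric])
      then show ?thesis using x s by (metis inv_closed m_closed inv_solve_right)
    qed
    then show "inv\<^bsub>B\<^esub> x \<in> centralizer B S" using x by (simp add: centralizer_def)
  qed
qed

text \<open>Taking centralizers is a Galois connection, so the centralizer of \<open>S\<close> and its own centralizer are
always each other's centralizer; only the factorization of \<open>B\<close> is left as a condition.\<close>
lemma almost_direct_factor_centralizer:
  assumes "group B" "S \<subseteq> carrier B"
    and "carrier B \<subseteq> centralizer B S <#>\<^bsub>B\<^esub> centralizer B (centralizer B S)"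
  shows "almost_direct_factor B (centralizer B S)"
proof -
  interpret group B by fact
  let ?B' = "centralizer B S" and ?B'' = "centralizer B (centralizer B S)"
  have B': "?B' \<subseteq> carrier B" and B'': "?B'' \<subseteq> carrier B" by (auto simp: centralizer_def)
  have "?B' = centralizer B ?B''"
  proof
    show "?B' \<subseteq> centralizer B ?B''" using B' by (rule subset_centralizer_centralizer)
    show "centralizer B ?B'' \<subseteq> ?B'"
      using subset_centralizer_centralizer[OF assms(2)] by (rule centralizer_antimono)
  qed
  moreover have "carrier B = ?B' <#>\<^bsub>B\<^esub> ?B''"
    using assms(3) set_mult_closed[OF B' B''] by blast
  ultimately show ?thesis
    unfolding almost_direct_factor_def almost_direct_pair_def
    using subgroup_centralizer[OF assms(1)] assms(2) B' by blast
qed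

section \<open>Homomorphic images of powers of the integers\<close>
lemma image_of_countable_ultrapower_of_intI:
  assumes Q: "group Q" and U: "nonprincipal_ultrafilter_on UNIV U"
    and \<psi>: "\<psi> \<in> hom (product_group (UNIV :: nat set) (\<lambda>_. integer_group)) Q"
    and triv: "\<And>a. a \<in> trivial_ae UNIV (\<lambda>_. integer_group) U \<Longrightarrow> \<psi> a = \<one>\<^bsub>Q\<^esub>"
  shows "image_of_countable_ultrapower_of_int Q
           (\<psi> ` carrier (product_group (UNIV :: nat set) (\<lambda>_. integer_group)))"
proof -
  let ?Z = "product_group (UNIV :: nat set) (\<lambda>_. integer_group)"
  let ?N = "trivial_ae (UNIV :: nat set) (\<lambda>_. integer_group) U"
  have "group ?Z" by simp
  then interpret h: group_hom ?Z Q \<psi>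
    using Q \<psi> by (simp add: group_hom_def group_hom_axioms_def)
  have N: "?N \<lhd> ?Z"
    using U by (intro trivial_ae_normal) (auto simp: nonprincipal_ultrafilter_on_def)
  moreover have "?N \<subseteq> kernel ?Z Q \<psi>"
    using triv by (auto simp: kernel_def trivial_ae_def)
  ultimately obtain g where g: "g \<in> hom (?Z Mod ?N) Q"
    and g_eq: "\<And>a. a \<in> carrier ?Z \<Longrightarrow> g (?N #>\<^bsub>?Z\<^esub> a) = \<psi> a"
    by (metis h.FactGroup_universal_kernel)
  have im: "g ` carrier (?Z Mod ?N) = \<psi> ` carrier ?Z"
    unfolding carrier_FactGroup image_image using g_eq by (intro image_cong) auto
  then have "g \<in> epi (ultraproduct UNIV (\<lambda>_. integer_group) U) (Q\<lparr>carrier := \<psi> ` carrier ?Z\<rparr>)"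
    using g unfolding epi_def ultraproduct_def by (auto simp: hom_def)
  then show ?thesis
    unfolding image_of_countable_ultrapower_of_int_def using h.img_is_subgroup U by blast
qed

lemma power_hom_product_group:
  fixes p :: "'i \<Rightarrow> 'k"
  assumes G: "\<And>i. i \<in> I \<Longrightarrow> group (G i)" and y: "y \<in> carrier (product_group I G)"
  shows "(\<lambda>a :: 'k \<Rightarrow> int. \<lambda>i\<in>I. y i [^]\<^bsub>G i\<^esub> a (p i))
           \<in> hom (product_group UNIV (\<lambda>_. integer_group)) (product_group I G)"
proof (rule homI)
  fix a :: "'k \<Rightarrow> int"
  have "y i [^]\<^bsub>G i\<^esub> a (p i) \<in> carrier (G i)" if "i \<in> I" for i
    using y that by (intro group.int_pow_closed[OF G]) auto
  then show "(\<lambda>i\<in>I. y i [^]\<^bsub>G i\<^esub> a (p i)) \<in> carrier (product_group I G)" by simp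
next
  fix a b :: "'k \<Rightarrow> int"
  have "y i [^]\<^bsub>G i\<^esub> (a (p i) + b (p i)) = y i [^]\<^bsub>G i\<^esub> a (p i) \<otimes>\<^bsub>G i\<^esub> y i [^]\<^bsub>G i\<^esub> b (p i)"
    if "i \<in> I" for i
    using y that by (intro group.int_pow_mult[OF G]) auto
  then show "(\<lambda>i\<in>I. y i [^]\<^bsub>G i\<^esub> (a \<otimes>\<^bsub>product_group UNIV (\<lambda>_. integer_group)\<^esub> b) (p i)) =
    (\<lambda>i\<in>I. y i [^]\<^bsub>G i\<^esub> a (p i)) \<otimes>\<^bsub>product_group I G\<^esub> (\<lambda>i\<in>I. y i [^]\<^bsub>G i\<^esub> b (p i))"
    by (auto intro!: restrict_ext)
qed

section \<open>Removing nonprincipal ultrafilters\<close>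
text \<open>For a finite family \<open>\<U>\<close>, this is the kernel condition behind the factorization of \<open>\<pi>f\<close> through the
corresponding ultraproducts. Unlike the factorization itself, it can be compared for different families
without changing the target of the natural map.\<close>
definition concentrated_on ::
  "'i set \<Rightarrow> ('i \<Rightarrow> ('g, 'm) monoid_scheme) \<Rightarrow> ('b, 'n) monoid_scheme \<Rightarrow> (('i \<Rightarrow> 'g) \<Rightarrow> 'b) \<Rightarrow>
   'i set set set \<Rightarrow> bool" where
  "concentrated_on I G B f \<U> \<longleftrightarrow>
     (\<forall>x \<in> carrier (product_group I G). (\<forall>U\<in>\<U>. x \<in> trivial_ae I G U) \<longrightarrow> f x \<in> center B)"

text \<open>The element \<open>x\<close> to be treated determines the splitting of the product: it is itself supported on
\<open>J\<close>, and everything supported on \<open>J\<close> inherits from \<open>x\<close> the triviality almost everywhere with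
respect to each ultrafilter in \<open>\<U>\<close>. Thus on the factor \<open>P\<^sub>J\<close> only the triviality with respect to \<open>V\<close>
matters, and that is where powers indexed through a partition into countably many \<open>V\<close>-null sets
come in.\<close>
lemma concentrated_on_remove_nonprincipal:
  fixes B :: "('b, 'm) monoid_scheme" and G :: "'i \<Rightarrow> ('g, 'n) monoid_scheme"
  assumes B: "group B" and G: "\<And>i. i \<in> I \<Longrightarrow> group (G i)"
    and f: "f \<in> hom (product_group I G) B"
    and onto: "\<And>b. b \<in> carrier B \<Longrightarrow>
          \<exists>z\<in>center B. \<exists>x\<in>carrier (product_group I G). b = z \<otimes>\<^bsub>B\<^esub> f x"
    and avoid: "\<And>B'. almost_direct_factor B B' \<Longrightarrow> B' \<noteq> center B \<Longrightarrow>
          \<exists>b \<in> carrier (B\<lparr>carrier := B'\<rparr> Mod center B).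
            \<not> (\<exists>K. image_of_countable_ultrapower_of_int (B\<lparr>carrier := B'\<rparr> Mod center B) K \<and> b \<in> K)"
    and small: "below_uncountable_measurables I"
    and V: "nonprincipal_ultrafilter_on I V" and \<U>: "\<And>W. W \<in> \<U> \<Longrightarrow> ultrafilter_on I W"
    and conc: "concentrated_on I G B f (insert V \<U>)"
  shows "concentrated_on I G B f \<U>"
  unfolding concentrated_on_def
proof (intro ballI impI)
  let ?P = "product_group I G"
  let ?Z = "center B"
  fix x assume xP: "x \<in> carrier ?P" and x: "\<forall>W\<in>\<U>. x \<in> trivial_ae I G W"
  interpret B: group B by fact
  interpret P: group ?P by (simp add: G)
  interpret f: group_hom ?P B f using f by unfold_locales
  have Zn: "?Z \<lhd> B" by (rule center_normal[OF B])
  interpret Zn: normal ?Z B by (rule Zn)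
  have Z_comm: "z \<otimes>\<^bsub>B\<^esub> s = s \<otimes>\<^bsub>B\<^esub> z" if "z \<in> ?Z" "s \<in> carrier B" for z s
    using that unfolding center_def centralizer_def by blast
  \<comment> \<open>The families supported on the support of \<open>x\<close>, and those supported on its complement.\<close>
  define PJ where "PJ = {y \<in> carrier ?P. \<forall>i\<in>I. x i = \<one>\<^bsub>G i\<^esub> \<longrightarrow> y i = \<one>\<^bsub>G i\<^esub>}"
  define PA where "PA = {y \<in> carrier ?P. \<forall>i\<in>I. x i \<noteq> \<one>\<^bsub>G i\<^esub> \<longrightarrow> y i = \<one>\<^bsub>G i\<^esub>}"
  have PJP: "y \<in> carrier ?P" if "y \<in> PJ" for y using that unfolding PJ_def by blast
  have PAP: "y \<in> carrier ?P" if "y \<in> PA" for y using that unfolding PA_def by blast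
  define C where "C = f ` PA"
  define B' where "B' = centralizer B C"
  have C: "C \<subseteq> carrier B" using PAP by (auto simp: C_def)
  have B': "subgroup B' B" unfolding B'_def by (rule subgroup_centralizer[OF B C])
  interpret B': subgroup B' B by (rule B')
  have ZB': "?Z \<subseteq> B'" unfolding B'_def by (rule center_subset_centralizer[OF C])
  have comm: "f y \<otimes>\<^bsub>B\<^esub> f w = f w \<otimes>\<^bsub>B\<^esub> f y" if y: "y \<in> PJ" and w: "w \<in> PA" for y w
  proof -
    have "y i \<otimes>\<^bsub>G i\<^esub> w i = w i \<otimes>\<^bsub>G i\<^esub> y i" if i: "i \<in> I" for i
    proof -
      interpret Gi: group "G i" by (rule G[OF i])
      have c: "y i \<in> carrier (G i)" "w i \<in> carrier (G i)" using PJP[OF y] PAP[OF w] i by auto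
      have "y i = \<one>\<^bsub>G i\<^esub> \<or> w i = \<one>\<^bsub>G i\<^esub>" using y w i unfolding PJ_def PA_def by blast
      then show ?thesis using c by auto
    qed
    then have "y \<otimes>\<^bsub>?P\<^esub> w = w \<otimes>\<^bsub>?P\<^esub> y" by (auto intro: restrict_ext)
    then show ?thesis using PJP[OF y] PAP[OF w] f.hom_mult by metis
  qed
  have fPJ: "f y \<in> B'" if "y \<in> PJ" for y
    using comm[OF that] PJP[OF that] f.hom_closed unfolding B'_def C_def centralizer_def by blast
  \<comment> \<open>Surjectivity modulo the center, combined with cutting a family into its two parts.\<close>
  have split: "\<exists>z\<in>?Z. \<exists>y\<in>PJ. \<exists>w\<in>PA. b = z \<otimes>\<^bsub>B\<^esub> f y \<otimes>\<^bsub>B\<^esub> f w" if b: "b \<in> carrier B" for b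
  proof -
    obtain z u where z: "z \<in> ?Z" and u: "u \<in> carrier ?P" and bu: "b = z \<otimes>\<^bsub>B\<^esub> f u"
      using onto[OF b] by blast
    define y where "y = (\<lambda>i\<in>I. if x i = \<one>\<^bsub>G i\<^esub> then \<one>\<^bsub>G i\<^esub> else u i)"
    define w where "w = (\<lambda>i\<in>I. if x i = \<one>\<^bsub>G i\<^esub> then u i else \<one>\<^bsub>G i\<^esub>)"
    have one: "\<one>\<^bsub>G i\<^esub> \<in> carrier (G i)" if "i \<in> I" for i
      using G[OF that] by (simp add: group.is_monoid)
    have y: "y \<in> PJ" and w: "w \<in> PA"
      using u one by (auto simp: PJ_def PA_def y_def w_def PiE_iff)
    have "u i = y i \<otimes>\<^bsub>G i\<^esub> w i" if i: "i \<in> I" for i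
    proof -
      interpret Gi: group "G i" by (rule G[OF i])
      have "u i \<in> carrier (G i)" using u i by auto
      then show ?thesis using i by (simp add: y_def w_def)
    qed
    then have "u = (\<lambda>i\<in>I. y i \<otimes>\<^bsub>G i\<^esub> w i)"
      using u by (intro extensionalityI[of _ I]) (simp_all add: PiE_iff)
    then have "u = y \<otimes>\<^bsub>?P\<^esub> w" by simp
    then have "f u = f y \<otimes>\<^bsub>B\<^esub> f w" using PJP[OF y] PAP[OF w] f.hom_mult by metis
    then have "b = z \<otimes>\<^bsub>B\<^esub> f y \<otimes>\<^bsub>B\<^esub> f w"
      using bu z PJP[OF y] PAP[OF w] by (simp add: B.m_assoc del: carrier_product_group)
    then show ?thesis using z y w by blast
  qed
  have adf: "almost_direct_factor B B'"
    unfolding B'_def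
  proof (rule almost_direct_factor_centralizer[OF B C], rule subsetI)
    fix b assume "b \<in> carrier B"
    then obtain z y w where z: "z \<in> ?Z" and y: "y \<in> PJ" and w: "w \<in> PA"
      and b: "b = z \<otimes>\<^bsub>B\<^esub> f y \<otimes>\<^bsub>B\<^esub> f w"
      using split by blast
    have "z \<otimes>\<^bsub>B\<^esub> f y \<in> centralizer B C"
      using ZB' z fPJ[OF y] B'.m_closed unfolding B'_def by blast
    moreover have "f w \<in> centralizer B (centralizer B C)"
      using subset_centralizer_centralizer[OF C] w unfolding C_def by blast
    ultimately show "b \<in> centralizer B C <#>\<^bsub>B\<^esub> centralizer B (centralizer B C)"
      unfolding b set_mult_def by blast
  qed
  show "f x \<in> ?Z"
  proof (cases "B' = ?Z")
    case True
    have "x \<in> PJ" using xP unfolding PJ_def by blast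
    then show ?thesis using fPJ True by blast
  next
    case False
    let ?Q = "B\<lparr>carrier := B'\<rparr> Mod ?Z"
    have coset_eq: "?Z #>\<^bsub>B\<lparr>carrier := B'\<rparr>\<^esub> b = ?Z #>\<^bsub>B\<^esub> b" for b
      by (simp add: r_coset_def)
    have ZnB': "?Z \<lhd> B\<lparr>carrier := B'\<rparr>" by (rule B.normal_restrict_supergroup[OF B' Zn ZB'])
    obtain X where XQ: "X \<in> carrier ?Q"
      and X: "\<And>K. image_of_countable_ultrapower_of_int ?Q K \<Longrightarrow> X \<notin> K"
      using avoid[OF adf False] by blast
    from XQ obtain b where b: "b \<in> B'" and Xb: "X = ?Z #>\<^bsub>B\<^esub> b"
      unfolding carrier_FactGroup coset_eq by auto
    obtain z y w where z: "z \<in> ?Z" and y: "y \<in> PJ" and w: "w \<in> PA"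
      and bzyw: "b = z \<otimes>\<^bsub>B\<^esub> f y \<otimes>\<^bsub>B\<^esub> f w"
      using split b B'.mem_carrier by blast
    have fy: "f y \<in> carrier B" and fw: "f w \<in> carrier B" and zc: "z \<in> carrier B"
      using PJP[OF y] PAP[OF w] z f.hom_closed Zn.mem_carrier by blast+
    \<comment> \<open>As a member of \<open>B'\<close>, \<open>f w\<close> commutes with \<open>f P\<^sub>A\<close>; as a member of \<open>f P\<^sub>A\<close>, with \<open>f P\<^sub>J\<close>. So it
      is central, and the class of \<open>b\<close> is the class of \<open>f y\<close>.\<close>
    have fwZ: "f w \<in> ?Z"
    proof -
      have zy: "z \<otimes>\<^bsub>B\<^esub> f y \<in> B'" using ZB' z fPJ[OF y] B'.m_closed by blast
      have "f w = inv\<^bsub>B\<^esub> (z \<otimes>\<^bsub>B\<^esub> f y) \<otimes>\<^bsub>B\<^esub> b"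
        unfolding bzyw using zc fy fw by (metis B.inv_solve_left' B.m_closed)
      then have "f w \<in> B'" using zy b B'.m_closed B'.m_inv_closed by metis
      then have cC: "f w \<otimes>\<^bsub>B\<^esub> f w' = f w' \<otimes>\<^bsub>B\<^esub> f w" if "w' \<in> PA" for w'
        using that unfolding B'_def C_def centralizer_def by blast
      have "f w \<otimes>\<^bsub>B\<^esub> s = s \<otimes>\<^bsub>B\<^esub> f w" if s: "s \<in> carrier B" for s
      proof -
        obtain z' y' w' where z': "z' \<in> ?Z" and y': "y' \<in> PJ" and w': "w' \<in> PA"
          and s': "s = z' \<otimes>\<^bsub>B\<^esub> f y' \<otimes>\<^bsub>B\<^esub> f w'"
          using split[OF s] by blast
        have car: "z' \<in> carrier B" "f y' \<in> carrier B" "f w' \<in> carrier B"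
          using PJP[OF y'] PAP[OF w'] z' f.hom_closed Zn.mem_carrier by blast+
        have "f w \<otimes>\<^bsub>B\<^esub> s = z' \<otimes>\<^bsub>B\<^esub> f w \<otimes>\<^bsub>B\<^esub> f y' \<otimes>\<^bsub>B\<^esub> f w'"
          using car fw Z_comm[OF z' fw] by (simp add: s' B.m_assoc[symmetric])
        also have "\<dots> = z' \<otimes>\<^bsub>B\<^esub> f y' \<otimes>\<^bsub>B\<^esub> f w \<otimes>\<^bsub>B\<^esub> f w'"
          using car fw comm[OF y' w] by (simp add: B.m_assoc)
        also have "\<dots> = s \<otimes>\<^bsub>B\<^esub> f w"
          using car fw cC[OF w'] by (simp add: s' B.m_assoc)
        finally show ?thesis .
      qed
      then show ?thesis using fw unfolding center_def centralizer_def by blast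
    qed
    have Xy: "X = ?Z #>\<^bsub>B\<^esub> f y"
    proof -
      have "b = (z \<otimes>\<^bsub>B\<^esub> f w) \<otimes>\<^bsub>B\<^esub> f y"
        unfolding bzyw using zc fy fw Z_comm[OF fwZ fy] by (simp add: B.m_assoc)
      then have "b \<in> ?Z #>\<^bsub>B\<^esub> f y"
        using z fwZ Zn.m_closed unfolding r_coset_def by blast
      then show ?thesis unfolding Xb
        using B.repr_independence[OF _ fy Zn.is_subgroup] by metis
    qed
    obtain p :: "'i \<Rightarrow> nat" where p: "\<And>n. {i \<in> I. p i = n} \<notin> V"
      using nonprincipal_ultrafilter_countable_null_partition[OF small V] by blast
    have Vu: "ultrafilter_on I V" using V by (simp add: nonprincipal_ultrafilter_on_def)
    let ?U = "pushforward I V p UNIV"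
    have U: "nonprincipal_ultrafilter_on UNIV ?U"
      by (rule nonprincipal_pushforward[OF Vu _ p]) simp
    let ?Zw = "product_group (UNIV :: nat set) (\<lambda>_. integer_group)"
    \<comment> \<open>Since \<open>p\<close> has null fibres, its image ultrafilter is nonprincipal. An integer sequence that
      vanishes almost everywhere for it gives a family of powers of \<open>y\<close> that is trivial almost everywhere
      for \<open>V\<close>, and the constant sequence 1 gives \<open>y\<close> back.\<close>
    define pw where "pw a = (\<lambda>i\<in>I. y i [^]\<^bsub>G i\<^esub> (a (p i) :: int))" for a
    have pw_hom: "pw \<in> hom ?Zw ?P"
      unfolding pw_def using G PJP[OF y] by (rule power_hom_product_group)
    have pwPJ: "pw a \<in> PJ" if a: "a \<in> carrier ?Zw" for a
      using hom_in_carrier[OF pw_hom a] y group.int_pow_one[OF G]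
      unfolding PJ_def pw_def by auto
    define \<psi> where "\<psi> a = ?Z #>\<^bsub>B\<^esub> f (pw a)" for a
    have "f \<circ> pw \<in> hom ?Zw (B\<lparr>carrier := B'\<rparr>)"
    proof (rule homI)
      fix a c assume ac: "a \<in> carrier ?Zw" "c \<in> carrier ?Zw"
      show "(f \<circ> pw) a \<in> carrier (B\<lparr>carrier := B'\<rparr>)" using fPJ[OF pwPJ[OF ac(1)]] by simp
      show "(f \<circ> pw) (a \<otimes>\<^bsub>?Zw\<^esub> c) = (f \<circ> pw) a \<otimes>\<^bsub>B\<lparr>carrier := B'\<rparr>\<^esub> (f \<circ> pw) c"
        using hom_mult[OF pw_hom ac] f.hom_mult[OF hom_in_carrier[OF pw_hom ac(1)] hom_in_carrier[OF pw_hom ac(2)]]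
        by (simp del: mult_product_group)
    qed
    from hom_compose[OF this normal.r_coset_hom_Mod[OF ZnB']]
    have \<psi>_hom: "\<psi> \<in> hom ?Zw ?Q" by (simp add: comp_def \<psi>_def[abs_def] coset_eq)
    have \<psi>_triv: "\<psi> a = \<one>\<^bsub>?Q\<^esub>" if a: "a \<in> trivial_ae UNIV (\<lambda>_. integer_group) ?U" for a
    proof -
      have aZ: "a \<in> carrier ?Zw" and aV: "{i \<in> I. a (p i) = 0} \<in> V"
        using a by (auto simp: trivial_ae_def pushforward_def)
      have pwP: "pw a \<in> carrier ?P" by (rule PJP[OF pwPJ[OF aZ]])
      have "{i \<in> I. pw a i = \<one>\<^bsub>G i\<^esub>} \<in> V"
        by (rule ultrafilter_on_mono[OF Vu aV]) (auto simp: pw_def)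
      then have "pw a \<in> trivial_ae I G V" using pwP by (simp add: trivial_ae_def del: carrier_product_group)
      moreover have "pw a \<in> trivial_ae I G W" if W: "W \<in> \<U>" for W
      proof -
        have "{i \<in> I. x i = \<one>\<^bsub>G i\<^esub>} \<in> W" using x W by (auto simp: trivial_ae_def)
        then have "{i \<in> I. pw a i = \<one>\<^bsub>G i\<^esub>} \<in> W"
          by (rule ultrafilter_on_mono[OF \<U>[OF W]]) (use pwPJ[OF aZ] in \<open>auto simp: PJ_def\<close>)
        then show ?thesis using pwP by (simp add: trivial_ae_def del: carrier_product_group)
      qed
      ultimately have "f (pw a) \<in> ?Z" using conc pwP unfolding concentrated_on_def by blast
      then show ?thesis using B.coset_join2[OF _ Zn.is_subgroup] Zn.mem_carrier by (simp add: \<psi>_def)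
    qed
    have "X = \<psi> (\<lambda>_. 1)"
    proof -
      have "pw (\<lambda>_. 1) = y"
        using PJP[OF y] G unfolding pw_def
        by (intro extensionalityI[of _ I]) (auto simp: PiE_iff group.int_pow_1)
      then show ?thesis by (simp add: \<psi>_def Xy)
    qed
    then have "X \<in> \<psi> ` carrier ?Zw" by auto
    moreover have "image_of_countable_ultrapower_of_int ?Q (\<psi> ` carrier ?Zw)"
      using normal.factorgroup_is_group[OF ZnB'] U \<psi>_hom \<psi>_triv
      by (rule image_of_countable_ultrapower_of_intI)
    ultimately show ?thesis using X by blast
  qed
qed

lemma concentrated_on_principal:
  assumes "group B" and G: "\<And>i. i \<in> I \<Longrightarrow> group (G i)"
    and "f \<in> hom (product_group I G) B"
    and "\<And>b. b \<in> carrier B \<Longrightarrow>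
          \<exists>z\<in>center B. \<exists>x\<in>carrier (product_group I G). b = z \<otimes>\<^bsub>B\<^esub> f x"
    and "\<And>B'. almost_direct_factor B B' \<Longrightarrow> B' \<noteq> center B \<Longrightarrow>
          \<exists>b \<in> carrier (B\<lparr>carrier := B'\<rparr> Mod center B).
            \<not> (\<exists>K. image_of_countable_ultrapower_of_int (B\<lparr>carrier := B'\<rparr> Mod center B) K \<and> b \<in> K)"
    and "below_uncountable_measurables I"
    and "finite \<U>" and "\<And>W. W \<in> \<U> \<Longrightarrow> ultrafilter_on I W"
    and "concentrated_on I G B f \<U>"
  shows "concentrated_on I G B f {W \<in> \<U>. \<not> nonprincipal_ultrafilter_on I W}"
  using assms(7-9)
proof (induction "card {W \<in> \<U>. nonprincipal_ultrafilter_on I W}" arbitrary: \<U>)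
  case 0
  then have "{W \<in> \<U>. \<not> nonprincipal_ultrafilter_on I W} = \<U>" by auto
  then show ?case using 0 by simp
next
  case (Suc n)
  then have "{W \<in> \<U>. nonprincipal_ultrafilter_on I W} \<noteq> {}" by (metis card.empty nat.distinct(1))
  then obtain V where V: "V \<in> \<U>" "nonprincipal_ultrafilter_on I V" by blast
  have "{W \<in> \<U> - {V}. nonprincipal_ultrafilter_on I W} = {W \<in> \<U>. nonprincipal_ultrafilter_on I W} - {V}"
    by blast
  then have "n = card {W \<in> \<U> - {V}. nonprincipal_ultrafilter_on I W}"
    using Suc.hyps(2) Suc.prems(1) V by simp
  moreover have "concentrated_on I G B f (\<U> - {V})"
  proof (rule concentrated_on_remove_nonprincipal[OF assms(1-6) V(2)])
    show "concentrated_on I G B f (insert V (\<U> - {V}))"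
      using Suc.prems(3) V(1) by (simp add: insert_absorb)
  qed (use Suc.prems(2) in auto)
  ultimately have "concentrated_on I G B f {W \<in> \<U> - {V}. \<not> nonprincipal_ultrafilter_on I W}"
    using Suc.hyps(1)[of "\<U> - {V}"] Suc.prems by blast
  moreover have "{W \<in> \<U> - {V}. \<not> nonprincipal_ultrafilter_on I W} = {W \<in> \<U>. \<not> nonprincipal_ultrafilter_on I W}"
    using V(2) by blast
  ultimately show ?case by simp
qed

section \<open>Reduction to finitely many factors\<close>
lemma center_proj_eq_iff:
  assumes "group B" "b \<in> carrier B"
  shows "center_proj B b = center B \<longleftrightarrow> b \<in> center B"
proof -
  interpret group B by fact
  interpret normal "center B" B by (rule center_normal[OF assms(1)])
  show ?thesis
    unfolding center_proj_def using assms(2) coset_join1 coset_join2 is_subgroup rcos_self by metis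
qed

lemma center_proj_hom: "group B \<Longrightarrow> center_proj B \<in> hom B (B Mod center B)"
  using normal.r_coset_hom_Mod[OF center_normal, of B] unfolding center_proj_def[abs_def] .

theorem theorem13:
  fixes B :: "('b, 'm) monoid_scheme"
    and I :: "'i set" and G :: "'i \<Rightarrow> 'g monoid" and f :: "('i \<Rightarrow> 'g) \<Rightarrow> 'b"
  assumes "group B"
    and "\<forall>(I' :: 'i set) (G' :: 'i \<Rightarrow> 'g monoid) f'.
           (\<forall>i\<in>I'. group (G' i)) \<longrightarrow>
           f' \<in> hom (product_group I' G') B \<longrightarrow>
           (center_proj B \<circ> f') ` carrier (product_group I' G') = carrier (B Mod center B) \<longrightarrow>
           factors_through_finitely_many_ultraproducts I' G' (B Mod center B) (center_proj B \<circ> f')"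
    and "\<forall>B'. almost_direct_factor B B' \<and> B' \<noteq> center B \<longrightarrow>
           (\<exists>b \<in> carrier (B\<lparr>carrier := B'\<rparr> Mod center B).
              \<not> (\<exists>K. image_of_countable_ultrapower_of_int (B\<lparr>carrier := B'\<rparr> Mod center B) K \<and> b \<in> K))"
    and "\<forall>i\<in>I. group (G i)"
    and "below_uncountable_measurables I"
    and "f \<in> hom (product_group I G) B"
    and "(center_proj B \<circ> f) ` carrier (product_group I G) = carrier (B Mod center B)"
  shows "factors_through_finite_subproduct I G (B Mod center B) (center_proj B \<circ> f)"
proof -
  let ?P = "product_group I G"
  let ?\<pi>f = "center_proj B \<circ> f"
  have G: "\<And>i. i \<in> I \<Longrightarrow> group (G i)" using assms(4) by blast
  interpret B: group B by fact
  interpret P: group ?P by (simp add: G)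
  interpret f: group_hom ?P B f using assms(6) by unfold_locales
  interpret Zn: normal "center B" B by (rule center_normal[OF assms(1)])
  have \<pi>f: "?\<pi>f \<in> hom ?P (B Mod center B)"
    using hom_compose[OF assms(6) center_proj_hom[OF assms(1)]] .
  interpret \<pi>f: group_hom ?P "B Mod center B" ?\<pi>f
    using \<pi>f by (intro group_hom.intro group_hom_axioms.intro P.is_group Zn.factorgroup_is_group)
  have onto: "\<exists>z\<in>center B. \<exists>x\<in>carrier ?P. b = z \<otimes>\<^bsub>B\<^esub> f x" if b: "b \<in> carrier B" for b
  proof -
    have "center B #>\<^bsub>B\<^esub> b \<in> carrier (B Mod center B)" using b unfolding carrier_FactGroup by blast
    then obtain x where x: "x \<in> carrier ?P" "center B #>\<^bsub>B\<^esub> b = center B #>\<^bsub>B\<^esub> f x"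
      using assms(7)[symmetric] by (auto simp: center_proj_def simp del: carrier_product_group)
    then have "b \<in> center B #>\<^bsub>B\<^esub> f x" using B.rcos_self[OF b Zn.is_subgroup] by simp
    then show ?thesis using x(1) unfolding r_coset_def by blast
  qed
  obtain n :: nat and U h where U: "\<And>k. k < n \<Longrightarrow> ultrafilter_on I (U k)"
    and h: "\<And>x. x \<in> carrier ?P \<Longrightarrow> ?\<pi>f x = h (\<lambda>k\<in>{..<n}. ultraproduct_map I G (U k) x)"
    using assms(2,4,6,7) unfolding factors_through_finitely_many_ultraproducts_def by metis
  define \<U> where "\<U> = U ` {..<n}"
  have "concentrated_on I G B f \<U>"
    unfolding concentrated_on_def
  proof (intro ballI impI)
    fix x assume x: "x \<in> carrier ?P" "\<forall>W\<in>\<U>. x \<in> trivial_ae I G W"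
    have "ultraproduct_map I G (U k) x = ultraproduct_map I G (U k) \<one>\<^bsub>?P\<^esub>" if k: "k < n" for k
    proof -
      have "{i \<in> I. x i = \<one>\<^bsub>G i\<^esub>} \<in> U k" using x(2) k by (auto simp: \<U>_def trivial_ae_def)
      moreover have "{i \<in> I. x i = \<one>\<^bsub>?P\<^esub> i} = {i \<in> I. x i = \<one>\<^bsub>G i\<^esub>}" by auto
      ultimately show ?thesis
        using ultraproduct_map_eq_iff[OF G U[OF k] x(1) P.one_closed] by metis
    qed
    then have "(\<lambda>k\<in>{..<n}. ultraproduct_map I G (U k) x) =
        (\<lambda>k\<in>{..<n}. ultraproduct_map I G (U k) \<one>\<^bsub>?P\<^esub>)"
      by (intro restrict_ext) simp
    then have "?\<pi>f x = ?\<pi>f \<one>\<^bsub>?P\<^esub>" using h[OF x(1)] h[OF P.one_closed] by metis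
    also have "\<dots> = center B" using \<pi>f.hom_one by (simp del: one_product_group)
    finally show "f x \<in> center B"
      using center_proj_eq_iff[OF assms(1) f.hom_closed[OF x(1)]] by simp
  qed
  then have conc: "concentrated_on I G B f {W \<in> \<U>. \<not> nonprincipal_ultrafilter_on I W}"
    using assms(1,3,5,6) G onto U
    by (intro concentrated_on_principal) (auto simp: \<U>_def simp del: carrier_product_group)
  \<comment> \<open>The remaining ultrafilters are principal, and \<open>J\<close> collects their generating points.\<close>
  define pt where "pt W = (SOME i. i \<in> I \<and> W = {A. A \<subseteq> I \<and> i \<in> A})" for W
  define J where "J = pt ` {W \<in> \<U>. \<not> nonprincipal_ultrafilter_on I W}"
  have pt: "pt W \<in> I \<and> W = {A. A \<subseteq> I \<and> pt W \<in> A}"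
    if "W \<in> \<U>" "\<not> nonprincipal_ultrafilter_on I W" for W
  proof -
    have "\<exists>i. i \<in> I \<and> W = {A. A \<subseteq> I \<and> i \<in> A}"
      using that U unfolding nonprincipal_ultrafilter_on_def \<U>_def by blast
    from someI_ex[OF this] show ?thesis unfolding pt_def .
  qed
  have J: "J \<subseteq> I" "finite J" using pt by (auto simp: J_def \<U>_def)
  have trivial: "?\<pi>f x = \<one>\<^bsub>B Mod center B\<^esub>"
    if x: "x \<in> carrier ?P" and xJ: "\<And>i. i \<in> J \<Longrightarrow> x i = \<one>\<^bsub>G i\<^esub>" for x
  proof -
    have "x \<in> trivial_ae I G W" if W: "W \<in> \<U>" "\<not> nonprincipal_ultrafilter_on I W" for W
    proof -
      have "pt W \<in> J" using W unfolding J_def by blast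
      then have "{i \<in> I. x i = \<one>\<^bsub>G i\<^esub>} \<in> W"
        by (subst pt[OF W, THEN conjunct2]) (use xJ J in auto)
      then show ?thesis using x by (simp add: trivial_ae_def del: carrier_product_group)
    qed
    then have "f x \<in> center B" using conc x unfolding concentrated_on_def by blast
    then show ?thesis using center_proj_eq_iff[OF assms(1) f.hom_closed[OF x]] by simp
  qed
  \<comment> \<open>The homomorphism on the finite subproduct extends by the identity element and then applies
    \<open>\<pi>f\<close>; a family and the extension of its restriction differ by one that is trivial on \<open>J\<close>.\<close>
  define ext where "ext y = (\<lambda>i\<in>I. if i \<in> J then y i else \<one>\<^bsub>G i\<^esub>)" for y
  have one: "\<one>\<^bsub>G i\<^esub> \<in> carrier (G i)" "\<one>\<^bsub>G i\<^esub> \<otimes>\<^bsub>G i\<^esub> \<one>\<^bsub>G i\<^esub> = \<one>\<^bsub>G i\<^esub>" if "i \<in> I" for i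
    using G[OF that] by (simp_all add: group.is_monoid)
  have ext_hom: "ext \<in> hom (product_group J G) ?P"
    using J(1) one by (intro homI) (auto simp: ext_def PiE_iff intro!: restrict_ext)
  have "?\<pi>f x = (?\<pi>f \<circ> ext) (restrict x J)" if x: "x \<in> carrier ?P" for x
  proof -
    let ?e = "ext (restrict x J)"
    have "restrict x J \<in> carrier (product_group J G)" using x J(1) by auto
    then have e: "?e \<in> carrier ?P" by (rule hom_in_carrier[OF ext_hom])
    have "(x \<otimes>\<^bsub>?P\<^esub> inv\<^bsub>?P\<^esub> ?e) i = \<one>\<^bsub>G i\<^esub>" if i: "i \<in> J" for i
    proof -
      have iI: "i \<in> I" using i J(1) by blast
      interpret Gi: group "G i" by (rule G[OF iI])
      have "inv\<^bsub>?P\<^esub> ?e = (\<lambda>i\<in>I. inv\<^bsub>G i\<^esub> ?e i)" using e G by (intro inv_product_group) auto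
      moreover have "?e i = x i" "x i \<in> carrier (G i)" using i iI x by (auto simp: ext_def)
      ultimately show ?thesis using iI by simp
    qed
    then have "?\<pi>f (x \<otimes>\<^bsub>?P\<^esub> inv\<^bsub>?P\<^esub> ?e) = \<one>\<^bsub>B Mod center B\<^esub>"
      by (rule trivial[OF P.m_closed[OF x P.inv_closed[OF e]]])
    then have "?\<pi>f x \<otimes>\<^bsub>B Mod center B\<^esub> inv\<^bsub>B Mod center B\<^esub> (?\<pi>f ?e) = \<one>\<^bsub>B Mod center B\<^esub>"
      using \<pi>f.hom_mult[OF x P.inv_closed[OF e]] \<pi>f.hom_inv[OF e] by metis
    then have "?\<pi>f x = ?\<pi>f ?e"
      using \<pi>f.hom_closed[OF x] \<pi>f.hom_closed[OF e]
      by (metis \<pi>f.H.inv_closed \<pi>f.H.inv_equality \<pi>f.H.inv_inv)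
    then show ?thesis by simp
  qed
  then show ?thesis
    unfolding factors_through_finite_subproduct_def
    using J hom_compose[OF ext_hom \<pi>f] by blast
qed

end
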